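(* For an integer $N\ge 0$ define the polynomials in $q$ $$S(2,3;q,N)=\sum_{m,n\ge 0}q^{m^2+3mn+3n^2+2m+3n}\begin{bmatrix}N-3n-m-1\\ m\end{bmatrix}_q^{\star}\begin{bmatrix}\lfloor\frac23N\rfloor-m-n\\ n\end{bmatrix}_{q^3},$$ $$S(3,6;q,N)=\sum_{m,n\ge 0}q^{m^2+3mn+3n^2+3m+6n}\begin{bmatrix}N-3n-m-2\\ m\end{bmatrix}_q\begin{bmatrix}\lfloor\frac23N\rfloor-1-m-n\\ n\end{bmatrix}_{q^3},$$ $$S(0,-1;q,N)=\sum_{m,n\ge 0}q^{m^2+3mn+3n^2-n}\begin{bmatrix}N+1-3n-m\\ m\end{bmatrix}_q\begin{bmatrix}\lfloor\frac23(N+2)\rfloor-m-n\\ n\end{bmatrix}_{q^3},$$ $$S(3,5;q,N)=\sum_{m,n\ge 0}q^{m^2+3mn+3n^2+3m+5n}\begin{bmatrix}N-3n-m-2\\ m\end{bmatrix}_q\begin{bmatrix}\lfloor\frac23(N-1)\rfloor-m-n\\ n\end{bmatrix}_{q^3},$$ and let $S(1,3;q,N):=S(2,3;q,N)+q^2S(3,6;q,N)$ and $S(0,2;q,N):=S(0,-1;q,N)-q^2S(3,5;q,N)$. Then $$S(1,3;q,N)=\sum_{m,n\ge 0}q^{m^2+3mn+3n^2+m+3n}\begin{bmatrix}N-m-3n\\ m\end{bmatrix}_q\begin{bmatrix}\lfloor\frac23N\rfloor-m-n\\ n\end{bmatrix}_{q^3},$$ $$S(0,2;q,N)=\sum_{m,n\ge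 0}q^{m^2+3mn+3n^2+2n}\begin{bmatrix}N+1-m-3n\\ m\end{bmatrix}_q\begin{bmatrix}\lfloor\frac23(N-1)\rfloor+1-m-n\\ n\end{bmatrix}_{q^3}.$$
   Context: Notation: $(x;q)_n=\prod_{i=0}^{n-1}(1-q^ix)$. For $k,l\in\mathbb{Z}$ the Gaussian binomial coefficient is $\begin{bmatrix}k\\ l\end{bmatrix}_q=\frac{(q;q)_k}{(q;q)_l(q;q)_{k-l}}$ if $k\ge l\ge 0$, and $0$ if $l<0$ or $k<l$; the subscript $q^3$ means that $q$ is replaced by $q^3$. The starred coefficient $\begin{bmatrix}k\\ l\end{bmatrix}_q^{\star}$ equals $\begin{bmatrix}k\\ l\end{bmatrix}_q$ except that $\begin{bmatrix}-1\\ 0\end{bmatrix}_q^{\star}=1$. $\lfloor x\rfloor$ is the greatest integer $\le x$. *)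

theory Defs
  imports
    Complex_Main
    "HOL-Library.Groups_Big_Fun"
    "HOL-Computational_Algebra.Polynomial"
begin

definition qpoch :: "'a::comm_ring_1 \<Rightarrow> 'a \<Rightarrow> nat \<Rightarrow> 'a" where
  "qpoch x q n = (\<Prod>i<n. 1 - q ^ i * x)"

text \<open>
  The quotient is taken in the ring itself. It is exact by \<open>gauss_binom_mult\<close> below, and for
  the bases used here (positive powers of the indeterminate) the denominator is nonzero by
  \<open>qpoch_X_nonzero\<close>. Replacing \<open>q\<close> by \<open>q\<^sup>3\<close> means passing the base \<open>q ^ 3\<close>.
\<close>

definition gauss_binom :: "'a::idom_divide \<Rightarrow> int \<Rightarrow> int \<Rightarrow> 'a" where
  "gauss_binom q k l =
     (if 0 \<le> l \<and> l \<le> k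
      then qpoch q q (nat k) div (qpoch q q (nat l) * qpoch q q (nat (k - l)))
      else 0)"

definition gauss_binom_star :: "'a::idom_divide \<Rightarrow> int \<Rightarrow> int \<Rightarrow> 'a" where
  "gauss_binom_star q k l = (if k = -1 \<and> l = 0 then 1 else gauss_binom q k l)"

lemma qpoch_Suc: "qpoch q q (Suc n) = qpoch q q n * (1 - q ^ Suc n)"
  by (simp add: qpoch_def mult.commute)

lemma qpoch_dvd: "qpoch q q k * qpoch q q l dvd qpoch q q (k + l)"
proof (induction "k + l" arbitrary: k l)
  case 0
  then show ?case by (simp add: qpoch_def)
next
  case (Suc s)
  show ?case
  proof (cases "k = 0 \<or> l = 0")
    case True
    then show ?thesis by (auto simp: qpoch_def)
  next
    case False
    then obtain i j where k: "k = Suc i" and l: "l = Suc j"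
      by (metis not0_implies_Suc)
    have "qpoch q q i * qpoch q q l dvd qpoch q q (i + l)"
      by (rule Suc.hyps(1)) (use Suc.hyps(2) k in simp)
    then have 1: "qpoch q q k * qpoch q q l dvd qpoch q q s * (1 - q ^ k)"
      using mult_dvd_mono[OF _ dvd_refl[of "1 - q ^ k"]] Suc.hyps(2)
      by (fastforce simp: k qpoch_Suc mult_ac)
    have "qpoch q q k * qpoch q q j dvd qpoch q q (k + j)"
      by (rule Suc.hyps(1)) (use Suc.hyps(2) l in simp)
    then have 2: "qpoch q q k * qpoch q q l dvd qpoch q q s * (1 - q ^ l)"
      using mult_dvd_mono[OF _ dvd_refl[of "1 - q ^ l"]] Suc.hyps(2)
      by (fastforce simp: l qpoch_Suc mult_ac)
    have "qpoch q q (k + l) = qpoch q q s * (1 - q ^ k) + q ^ k * (qpoch q q s * (1 - q ^ l))"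
      by (simp only: Suc.hyps(2)[symmetric] qpoch_Suc)
        (simp only: Suc.hyps(2) power_add algebra_simps, simp)
    then show ?thesis using 1 2 by (metis dvd_add dvd_mult)
  qed
qed

lemma gauss_binom_mult:
  assumes "0 \<le> l" "l \<le> k"
  shows "gauss_binom q k l * (qpoch q q (nat l) * qpoch q q (nat (k - l))) = qpoch q q (nat k)"
proof -
  define d where "d = qpoch q q (nat l) * qpoch q q (nat (k - l))"
  have "nat l + nat (k - l) = nat k" using assms by simp
  then have "d dvd qpoch q q (nat k)"
    using qpoch_dvd[of q "nat l" "nat (k - l)"] by (simp add: d_def)
  then obtain c where c: "qpoch q q (nat k) = c * d"
    by (metis dvdE mult.commute)
  have "qpoch q q (nat k) div d * d = qpoch q q (nat k)"
    by (cases "d = 0") (simp_all add: c)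
  then show ?thesis using assms by (simp add: gauss_binom_def d_def)
qed

text \<open>The indeterminate \<open>q\<close>.\<close>

abbreviation X :: "int poly" where
  "X \<equiv> monom 1 1"

lemma qpoch_X_nonzero: "0 < d \<Longrightarrow> qpoch (X ^ d) (X ^ d) n \<noteq> 0"
proof
  assume "0 < d" and *: "qpoch (X ^ d) (X ^ d) n = 0"
  then have "poly (qpoch (X ^ d) (X ^ d) n) 0 = 1"
    by (simp add: qpoch_def poly_prod poly_monom power_0_left)
  with * show False by simp
qed

text \<open>
  \<open>Sum_any\<close> is the sum over all pairs \<open>(m, n)\<close> of natural numbers. All its summands below have
  finite support by the lemmas \<open>finite_support_gauss_binom\<close> and
  \<open>finite_support_gauss_binom_star\<close>.
  The natural-number subtraction in \<open>S_0_m1\<close> does not truncate because \<open>n \<le> 3 * n\<^sup>2\<close>.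
\<close>

definition S_2_3 :: "nat \<Rightarrow> int poly" where
  "S_2_3 N = Sum_any (\<lambda>(m::nat, n::nat).
     X ^ (m^2 + 3*m*n + 3*n^2 + 2*m + 3*n)
     * gauss_binom_star X (int N - 3 * int n - int m - 1) (int m)
     * gauss_binom (X ^ 3) (\<lfloor>2/3 * real N\<rfloor> - int m - int n) (int n))"

definition S_3_6 :: "nat \<Rightarrow> int poly" where
  "S_3_6 N = Sum_any (\<lambda>(m::nat, n::nat).
     X ^ (m^2 + 3*m*n + 3*n^2 + 3*m + 6*n)
     * gauss_binom X (int N - 3 * int n - int m - 2) (int m)
     * gauss_binom (X ^ 3) (\<lfloor>2/3 * real N\<rfloor> - 1 - int m - int n) (int n))"

definition S_0_m1 :: "nat \<Rightarrow> int poly" where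
  "S_0_m1 N = Sum_any (\<lambda>(m::nat, n::nat).
     X ^ (m^2 + 3*m*n + 3*n^2 - n)
     * gauss_binom X (int N + 1 - 3 * int n - int m) (int m)
     * gauss_binom (X ^ 3) (\<lfloor>2/3 * (real N + 2)\<rfloor> - int m - int n) (int n))"

definition S_3_5 :: "nat \<Rightarrow> int poly" where
  "S_3_5 N = Sum_any (\<lambda>(m::nat, n::nat).
     X ^ (m^2 + 3*m*n + 3*n^2 + 3*m + 5*n)
     * gauss_binom X (int N - 3 * int n - int m - 2) (int m)
     * gauss_binom (X ^ 3) (\<lfloor>2/3 * (real N - 1)\<rfloor> - int m - int n) (int n))"

definition S_1_3 :: "nat \<Rightarrow> int poly" where
  "S_1_3 N = S_2_3 N + X^2 * S_3_6 N"

definition S_0_2 :: "nat \<Rightarrow> int poly" where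
  "S_0_2 N = S_0_m1 N - X^2 * S_3_5 N"

lemma finite_support_gauss_binom_star:
  fixes F :: "nat \<Rightarrow> nat \<Rightarrow> int poly"
  shows "finite {p. (case p of (m, n) \<Rightarrow>
           E m n * gauss_binom_star X (int N - 3 * int n - int m + s) (int m) * F m n) \<noteq> 0}"
proof (rule finite_subset)
  show "{p. (case p of (m, n) \<Rightarrow>
           E m n * gauss_binom_star X (int N - 3 * int n - int m + s) (int m) * F m n) \<noteq> 0}
        \<subseteq> {..nat (int N + s + 1)} \<times> {..nat (int N + s + 1)}"
    by (auto simp: gauss_binom_star_def gauss_binom_def split: if_splits)
qed simp

lemma finite_support_gauss_binom:
  fixes F :: "nat \<Rightarrow> nat \<Rightarrow> int poly"
  shows "finite {p. (case p of (m, n) \<Rightarrow>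
           E m n * gauss_binom X (int N - 3 * int n - int m + s) (int m) * F m n) \<noteq> 0}"
proof (rule finite_subset)
  show "{p. (case p of (m, n) \<Rightarrow>
           E m n * gauss_binom X (int N - 3 * int n - int m + s) (int m) * F m n) \<noteq> 0}
        \<subseteq> {..nat (int N + s + 1)} \<times> {..nat (int N + s + 1)}"
    by (auto simp: gauss_binom_def split: if_splits)
qed simp

end

theory Submission
  imports Defs
begin

text \<open>
  Both identities are one application of the \<open>q\<close>-Pascal rule
  \<open>[k, l] = q\<^sup>l [k - 1, l] + [k - 1, l - 1]\<close>, applied to every summand and followed by an index shift.

  For \<open>S(1,3)\<close>, expand the coefficient with base \<open>q\<close> and lower index \<open>m\<close> on the right-hand side.
  The terms with factor \<open>q\<^sup>m\<close> add up to \<open>S(2,3)\<close>. The others vanish for \<open>m = 0\<close> and become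
  \<open>q\<^sup>2 S(3,6)\<close> on replacing \<open>m\<close> by \<open>m + 1\<close>. The rule fails only at \<open>k = l = 0\<close>, and there the
  starred coefficient in \<open>S(2,3)\<close> restores it.

  For \<open>S(0,2)\<close>, expand the coefficient with base \<open>q\<^sup>3\<close> and lower index \<open>n\<close> in \<open>S(0,-1)\<close>. The terms
  with factor \<open>q\<^bsup>3n\<^esup>\<close> add up to the right-hand side, and the others become \<open>q\<^sup>2 S(3,5)\<close> on replacing
  \<open>n\<close> by \<open>n + 1\<close>. The exceptional case \<open>k = l = 0\<close> means \<open>n = 0\<close> and
  \<open>m = \<lfloor>2(N + 2)/3\<rfloor> > N + 1 - m\<close>, so the other coefficient \<open>[N + 1 - m, m]\<close> vanishes.
\<close>

section \<open>The \<open>q\<close>-Pascal rule\<close>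

lemma qpoch_0 [simp]: "qpoch x q 0 = 1"
  by (simp add: qpoch_def)

lemma gauss_binom_eq_0: "l < 0 \<or> k < l \<Longrightarrow> gauss_binom q k l = 0"
  by (auto simp: gauss_binom_def)

lemma gauss_binom_0_right: "0 \<le> k \<Longrightarrow> qpoch q q (nat k) \<noteq> 0 \<Longrightarrow> gauss_binom q k 0 = 1"
  by (simp add: gauss_binom_def)

lemma gauss_binom_self: "0 \<le> k \<Longrightarrow> qpoch q q (nat k) \<noteq> 0 \<Longrightarrow> gauss_binom q k k = 1"
  by (simp add: gauss_binom_def)

text \<open>
  The \<open>q\<close>-Pascal rule for all integers \<open>k\<close>. The case \<open>k = l = 0\<close> is a genuine exception, since
  \<open>[0, 0] = 1\<close> while \<open>[-1, 0] = [-1, -1] = 0\<close>.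
\<close>

lemma gauss_binom_pascal:
  fixes q :: "'a::idom_divide"
  assumes nz: "\<And>n. qpoch q q n \<noteq> 0" and "k \<noteq> 0 \<or> l \<noteq> 0"
  shows "gauss_binom q k (int l) =
    q ^ l * gauss_binom q (k - 1) (int l) + gauss_binom q (k - 1) (int l - 1)"
proof -
  consider "k < int l" | "l = 0" "0 < k" | "0 < l" "k = int l" | "0 < l" "int l < k"
    using assms(2) by linarith
  then show ?thesis
  proof cases
    case 1
    then show ?thesis by (simp add: gauss_binom_eq_0)
  next
    case 2
    then show ?thesis by (simp add: gauss_binom_eq_0 gauss_binom_0_right nz)
  next
    case 3
    then show ?thesis by (simp add: gauss_binom_eq_0 gauss_binom_self nz)
  next
    case 4
    define L where "L = l - 1"
    define D where "D = nat (k - int l - 1)"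
    have l: "l = Suc L" and k: "k = int (L + D + 2)"
      using 4 by (auto simp: L_def D_def)
    let ?P = "qpoch q q"
    let ?a = "gauss_binom q k (int l)"
    let ?b = "gauss_binom q (k - 1) (int l)"
    let ?c = "gauss_binom q (k - 1) (int l - 1)"
    have idx: "nat (k - int l) = Suc D" "nat (k - 1 - int l) = D"
      "nat (k - 1 - (int l - 1)) = Suc D" "nat (int l - 1) = L" "nat (int l) = Suc L"
      "nat k = Suc (L + D + 1)" "nat (k - 1) = L + D + 1"
      by (auto simp: l k)
    have a: "?a * (?P (Suc L) * ?P (Suc D)) = ?P (Suc (L + D + 1))"
      using gauss_binom_mult[of "int l" k q] 4 unfolding idx by simp
    have b: "?b * (?P (Suc L) * ?P D) = ?P (L + D + 1)"
      using gauss_binom_mult[of "int l" "k - 1" q] 4 unfolding idx by simp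
    have c: "?c * (?P L * ?P (Suc D)) = ?P (L + D + 1)"
      using gauss_binom_mult[of "int l - 1" "k - 1" q] 4 unfolding idx by simp
    have "(q ^ l * ?b + ?c) * (?P (Suc L) * ?P (Suc D))
        = q ^ l * (1 - q ^ Suc D) * (?b * (?P (Suc L) * ?P D))
          + (1 - q ^ Suc L) * (?c * (?P L * ?P (Suc D)))"
      by (simp only: qpoch_Suc) (simp only: algebra_simps)
    also have "\<dots> = (q ^ Suc L * (1 - q ^ Suc D) + (1 - q ^ Suc L)) * ?P (L + D + 1)"
      unfolding b c unfolding l by (simp only: algebra_simps power_Suc mult_1_left mult_1_right)
    also have "q ^ Suc L * (1 - q ^ Suc D) + (1 - q ^ Suc L) = 1 - q ^ Suc (L + D + 1)"
      by (simp add: algebra_simps power_add)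
    also have "\<dots> * ?P (L + D + 1) = ?a * (?P (Suc L) * ?P (Suc D))"
      unfolding a qpoch_Suc[of q "L + D + 1"] by (simp only: mult.commute)
    finally show ?thesis
      using nz by simp
  qed
qed

lemma gauss_binom_star_pascal:
  fixes q :: "'a::idom_divide"
  assumes nz: "\<And>n. qpoch q q n \<noteq> 0"
  shows "gauss_binom q k (int l) =
    q ^ l * gauss_binom_star q (k - 1) (int l) + gauss_binom q (k - 1) (int l - 1)"
proof (cases "k = 0 \<and> l = 0")
  case True
  then show ?thesis
    by (simp add: gauss_binom_star_def gauss_binom_eq_0 gauss_binom_0_right)
next
  case False
  then show ?thesis
    using gauss_binom_pascal[OF nz, of k l] by (auto simp: gauss_binom_star_def)
qed

section \<open>Index shifts in double sums\<close>

text \<open>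
  No finiteness assumption is needed: the two supports are in bijection, and \<open>Sum_any\<close> is \<open>0\<close> when
  they are infinite.
\<close>

lemma Sum_any_reindex_inj:
  assumes "inj h" and "\<And>x. x \<notin> range h \<Longrightarrow> g x = 0"
  shows "Sum_any g = Sum_any (\<lambda>x. g (h x))"
proof -
  have supp: "{x. g x \<noteq> 0} = h ` {x. g (h x) \<noteq> 0}"
  proof (intro equalityI subsetI)
    fix y assume "y \<in> {x. g x \<noteq> 0}"
    then obtain x where "y = h x" "g (h x) \<noteq> 0"
      using assms(2)[of y] by auto
    then show "y \<in> h ` {x. g (h x) \<noteq> 0}"
      by simp
  qed auto
  have "inj_on h {x. g (h x) \<noteq> 0}"
    by (rule inj_on_subset[OF assms(1)]) simp
  from sum.reindex[OF this, of g] show ?thesis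
    unfolding Sum_any.expand_set supp by (simp add: comp_def)
qed

lemma Sum_any_shift_fst:
  fixes g :: "nat \<Rightarrow> nat \<Rightarrow> 'a::comm_monoid_add"
  assumes "\<And>n. g 0 n = 0"
  shows "Sum_any (\<lambda>(m, n). g m n) = Sum_any (\<lambda>(m, n). g (Suc m) n)"
proof -
  have "(case p of (m, n) \<Rightarrow> g m n) = 0" if "p \<notin> range (\<lambda>(m, n). (Suc m, n))" for p
    using that assms by (cases p; cases "fst p") (auto simp: image_iff)
  then show ?thesis
    by (subst Sum_any_reindex_inj[where h = "\<lambda>(m, n). (Suc m, n)"])
      (auto simp: inj_def case_prod_unfold)
qed

lemma Sum_any_shift_snd:
  fixes g :: "nat \<Rightarrow> nat \<Rightarrow> 'a::comm_monoid_add"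
  assumes "\<And>m. g m 0 = 0"
  shows "Sum_any (\<lambda>(m, n). g m n) = Sum_any (\<lambda>(m, n). g m (Suc n))"
proof -
  have "(case p of (m, n) \<Rightarrow> g m n) = 0" if "p \<notin> range (\<lambda>(m, n). (m, Suc n))" for p
    using that assms by (cases p; cases "snd p") (auto simp: image_iff)
  then show ?thesis
    by (subst Sum_any_reindex_inj[where h = "\<lambda>(m, n). (m, Suc n)"])
      (auto simp: inj_def case_prod_unfold)
qed

section \<open>The two polynomial identities\<close>

lemma qpoch_X_nonzero': "qpoch X X n \<noteq> 0"
  using qpoch_X_nonzero[of 1 n] by simp

lemma S_1_3_eq:
  "S_1_3 N = Sum_any (\<lambda>(m::nat, n::nat).
     X ^ (m^2 + 3*m*n + 3*n^2 + m + 3*n)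
     * gauss_binom X (int N - int m - 3 * int n) (int m)
     * gauss_binom (X ^ 3) (\<lfloor>2/3 * real N\<rfloor> - int m - int n) (int n))"
proof -
  define F where "F m n = gauss_binom (X ^ 3) (\<lfloor>2/3 * real N\<rfloor> - int m - int n) (int n)"
    for m n :: nat
  define A where "A m n = X ^ (m^2 + 3*m*n + 3*n^2 + 2*m + 3*n)
     * gauss_binom_star X (int N - 3 * int n - int m - 1) (int m) * F m n" for m n :: nat
  define B where "B m n = X ^ (m^2 + 3*m*n + 3*n^2 + m + 3*n)
     * gauss_binom X (int N - 3 * int n - int m - 1) (int m - 1) * F m n" for m n :: nat
  have split: "X ^ (m^2 + 3*m*n + 3*n^2 + m + 3*n)
     * gauss_binom X (int N - int m - 3 * int n) (int m) * F m n = A m n + B m n" for m n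
  proof -
    have pow: "X ^ (m^2 + 3*m*n + 3*n^2 + 2*m + 3*n) = X ^ (m^2 + 3*m*n + 3*n^2 + m + 3*n) * X ^ m"
      unfolding power_add[symmetric] by (simp add: algebra_simps)
    have arg: "int N - int m - 3 * int n - 1 = int N - 3 * int n - int m - 1"
      by simp
    show ?thesis
      unfolding gauss_binom_star_pascal[OF qpoch_X_nonzero', of "int N - int m - 3 * int n" m]
        A_def B_def pow arg
      by (simp only: algebra_simps)
  qed
  have finA: "finite {p. (case p of (m, n) \<Rightarrow> A m n) \<noteq> 0}"
    using finite_support_gauss_binom_star[where s = "-1" and F = F and N = N] by (simp add: A_def)
  have finB: "finite {p. (case p of (m, n) \<Rightarrow> B m n) \<noteq> 0}"
    by (rule finite_subset[of _ "{..N} \<times> {..N}"])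
      (auto simp: B_def gauss_binom_def split: if_splits)
  have shift: "B (Suc m) n = X^2 * (X ^ (m^2 + 3*m*n + 3*n^2 + 3*m + 6*n)
     * gauss_binom X (int N - 3 * int n - int m - 2) (int m)
     * gauss_binom (X ^ 3) (\<lfloor>2/3 * real N\<rfloor> - 1 - int m - int n) (int n))" for m n
  proof -
    have pow: "X ^ ((Suc m)^2 + 3 * Suc m * n + 3*n^2 + Suc m + 3*n)
        = X^2 * X ^ (m^2 + 3*m*n + 3*n^2 + 3*m + 6*n)"
      unfolding power_add[symmetric] by (simp add: algebra_simps power2_eq_square)
    have arg: "int N - 3 * int n - int (Suc m) - 1 = int N - 3 * int n - int m - 2"
      "int (Suc m) - 1 = int m"
      "\<lfloor>2/3 * real N\<rfloor> - int (Suc m) - int n = \<lfloor>2/3 * real N\<rfloor> - 1 - int m - int n"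
      by simp_all
    show ?thesis
      unfolding B_def F_def pow arg by (simp only: mult.assoc)
  qed
  have fin36: "finite {p. (case p of (m::nat, n::nat) \<Rightarrow> X ^ (m^2 + 3*m*n + 3*n^2 + 3*m + 6*n)
     * gauss_binom X (int N - 3 * int n - int m - 2) (int m)
     * gauss_binom (X ^ 3) (\<lfloor>2/3 * real N\<rfloor> - 1 - int m - int n) (int n)) \<noteq> 0}"
    using finite_support_gauss_binom[where s = "-2" and N = N] by simp
  have "Sum_any (\<lambda>(m, n). B m n) = Sum_any (\<lambda>(m, n). B (Suc m) n)"
    by (rule Sum_any_shift_fst) (simp add: B_def gauss_binom_eq_0)
  also have "\<dots> = X^2 * S_3_6 N"
    unfolding S_3_6_def Sum_any_right_distrib[OF fin36] shift by (simp add: case_prod_unfold)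
  finally have "Sum_any (\<lambda>(m, n). B m n) = X^2 * S_3_6 N" .
  moreover have "Sum_any (\<lambda>(m, n). A m n) = S_2_3 N"
    by (simp add: S_2_3_def A_def F_def)
  moreover have "Sum_any (\<lambda>(m, n). A m n + B m n)
      = Sum_any (\<lambda>(m, n). A m n) + Sum_any (\<lambda>(m, n). B m n)"
    using Sum_any.distrib[OF finA finB] by (simp add: case_prod_unfold)
  ultimately show ?thesis
    unfolding S_1_3_def F_def[symmetric] split by simp
qed

lemma S_0_2_eq:
  "S_0_2 N = Sum_any (\<lambda>(m::nat, n::nat).
     X ^ (m^2 + 3*m*n + 3*n^2 + 2*n)
     * gauss_binom X (int N + 1 - int m - 3 * int n) (int m)
     * gauss_binom (X ^ 3) (\<lfloor>2/3 * (real N - 1)\<rfloor> + 1 - int m - int n) (int n))"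
proof -
  define C where "C = \<lfloor>2/3 * (real N + 2)\<rfloor>"
  have C': "\<lfloor>2/3 * (real N - 1)\<rfloor> = C - 2"
  proof -
    have "2/3 * (real N + 2) = 2/3 * (real N - 1) + 2"
      by (simp add: field_simps)
    then show ?thesis
      unfolding C_def by linarith
  qed
  have C_large: "int N + 1 < 2 * C"
  proof -
    have "2/3 * (real N + 2) < of_int C + 1"
      unfolding C_def by linarith
    then have "real_of_int (2 * int N + 1) < real_of_int (3 * C)"
      by simp
    then have "2 * int N + 1 < 3 * C"
      by (simp only: of_int_less_iff)
    then show ?thesis
      by presburger
  qed
  define G where "G m n = gauss_binom X (int N + 1 - 3 * int n - int m) (int m)" for m n :: nat
  define A where "A m n = X ^ (m^2 + 3*m*n + 3*n^2 + 2*n) * G m n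
     * gauss_binom (X ^ 3) (C - 1 - int m - int n) (int n)" for m n :: nat
  define B where "B m n = X ^ (m^2 + 3*m*n + 3*n^2 - n) * G m n
     * gauss_binom (X ^ 3) (C - 1 - int m - int n) (int n - 1)" for m n :: nat
  have split: "X ^ (m^2 + 3*m*n + 3*n^2 - n) * G m n
     * gauss_binom (X ^ 3) (C - int m - int n) (int n) = A m n + B m n" for m n
  proof (cases "C - int m - int n = 0 \<and> n = 0")
    case True
    \<comment> \<open>the \<open>q\<close>-Pascal rule fails here, but the other coefficient vanishes because \<open>m = C\<close>\<close>
    then have "G m n = 0"
      using C_large by (simp add: G_def gauss_binom_eq_0)
    then show ?thesis
      by (simp add: A_def B_def)
  next
    case False
    \<comment> \<open>so the subtraction in the exponent is exact\<close>
    have "n \<le> 3 * n^2"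
      by (simp add: power2_eq_square le_square trans_le_add1)
    then have pow: "X ^ (m^2 + 3*m*n + 3*n^2 + 2*n) = X ^ (m^2 + 3*m*n + 3*n^2 - n) * (X ^ 3) ^ n"
      unfolding power_add[symmetric] power_mult[symmetric]
      by (intro arg_cong[where f = "\<lambda>e. X ^ e"]) linarith
    have arg: "C - int m - int n - 1 = C - 1 - int m - int n"
      by simp
    have nz: "qpoch (X ^ 3) (X ^ 3) j \<noteq> 0" for j
      by (rule qpoch_X_nonzero) simp
    have "C - int m - int n \<noteq> 0 \<or> n \<noteq> 0"
      using False by simp
    from gauss_binom_pascal[OF nz this]
    have "gauss_binom (X ^ 3) (C - int m - int n) (int n)
        = (X ^ 3) ^ n * gauss_binom (X ^ 3) (C - 1 - int m - int n) (int n)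
          + gauss_binom (X ^ 3) (C - 1 - int m - int n) (int n - 1)"
      unfolding arg .
    then show ?thesis
      unfolding A_def B_def pow by (simp only: algebra_simps)
  qed
  have finA: "finite {p. (case p of (m, n) \<Rightarrow> A m n) \<noteq> 0}"
    and finB: "finite {p. (case p of (m, n) \<Rightarrow> B m n) \<noteq> 0}"
    by (rule finite_subset[of _ "{..N + 1} \<times> {..N + 1}"];
        auto simp: A_def B_def G_def gauss_binom_def split: if_splits)+
  have shift: "B m (Suc n) = X^2 * (X ^ (m^2 + 3*m*n + 3*n^2 + 3*m + 5*n)
     * gauss_binom X (int N - 3 * int n - int m - 2) (int m)
     * gauss_binom (X ^ 3) (C - 2 - int m - int n) (int n))" for m n
  proof -
    have pow: "X ^ (m^2 + 3*m * Suc n + 3 * (Suc n)^2 - Suc n)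
        = X^2 * X ^ (m^2 + 3*m*n + 3*n^2 + 3*m + 5*n)"
      unfolding power_add[symmetric]
      by (intro arg_cong[where f = "\<lambda>e. X ^ e"]) (simp add: algebra_simps power2_eq_square)
    have arg: "int N + 1 - 3 * int (Suc n) - int m = int N - 3 * int n - int m - 2"
      "int (Suc n) - 1 = int n"
      "C - 1 - int m - int (Suc n) = C - 2 - int m - int n"
      by simp_all
    show ?thesis
      unfolding B_def G_def pow arg by (simp only: mult.assoc)
  qed
  have fin35: "finite {p. (case p of (m::nat, n::nat) \<Rightarrow> X ^ (m^2 + 3*m*n + 3*n^2 + 3*m + 5*n)
     * gauss_binom X (int N - 3 * int n - int m - 2) (int m)
     * gauss_binom (X ^ 3) (C - 2 - int m - int n) (int n)) \<noteq> 0}"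
    using finite_support_gauss_binom[where s = "-2" and N = N] by simp
  have "Sum_any (\<lambda>(m, n). B m n) = Sum_any (\<lambda>(m, n). B m (Suc n))"
    by (rule Sum_any_shift_snd) (simp add: B_def gauss_binom_eq_0)
  also have "\<dots> = X^2 * S_3_5 N"
    unfolding S_3_5_def C' Sum_any_right_distrib[OF fin35] shift by (simp add: case_prod_unfold)
  finally have B: "Sum_any (\<lambda>(m, n). B m n) = X^2 * S_3_5 N" .
  have "S_0_m1 N = Sum_any (\<lambda>(m, n). A m n + B m n)"
    unfolding S_0_m1_def C_def[symmetric] G_def[symmetric] split ..
  also have "\<dots> = Sum_any (\<lambda>(m, n). A m n) + Sum_any (\<lambda>(m, n). B m n)"
    using Sum_any.distrib[OF finA finB] by (simp add: case_prod_unfold)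
  finally have "S_0_2 N = Sum_any (\<lambda>(m, n). A m n)"
    unfolding S_0_2_def B by simp
  also have "\<dots> = Sum_any (\<lambda>(m::nat, n::nat).
     X ^ (m^2 + 3*m*n + 3*n^2 + 2*n)
     * gauss_binom X (int N + 1 - int m - 3 * int n) (int m)
     * gauss_binom (X ^ 3) (C - 2 + 1 - int m - int n) (int n))"
  proof -
    have arg: "int N + 1 - 3 * int n - int m = int N + 1 - int m - 3 * int n" "C - 1 = C - 2 + 1"
      for m n :: nat
      by simp_all
    show ?thesis
      unfolding A_def G_def arg ..
  qed
  finally show ?thesis
    unfolding C' .
qed

theorem proposition4p2:
  fixes N :: nat
  shows "S_1_3 N = Sum_any (\<lambda>(m::nat, n::nat).
           X ^ (m^2 + 3*m*n + 3*n^2 + m + 3*n)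
           * gauss_binom X (int N - int m - 3 * int n) (int m)
           * gauss_binom (X ^ 3) (\<lfloor>2/3 * real N\<rfloor> - int m - int n) (int n))
       \<and> S_0_2 N = Sum_any (\<lambda>(m::nat, n::nat).
           X ^ (m^2 + 3*m*n + 3*n^2 + 2*n)
           * gauss_binom X (int N + 1 - int m - 3 * int n) (int m)
           * gauss_binom (X ^ 3) (\<lfloor>2/3 * (real N - 1)\<rfloor> + 1 - int m - int n) (int n))"
  using S_1_3_eq S_0_2_eq by blast

end
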